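(* Let $\eta>0$, $n=|\mathcal{N}_h|$, and let $\mathcal{A},\mathcal{B}_{\mathrm{bd}}\in\mathbb{R}^{2n\times 2n}$ be the saddle point matrix and block diagonal preconditioner $$\mathcal{A}=\begin{pmatrix} \bar K & M\\ M & -\eta\bar K\end{pmatrix},\qquad \mathcal{B}_{\mathrm{bd}}=\begin{pmatrix} \bar K+\eta^{-1/2}M & 0\\ 0 & \eta\bar K+\eta^{1/2}M\end{pmatrix}.$$ Let $\mathcal{N}_h^\bullet\subseteq\mathcal{N}_h$ be a set of truncated nodes with $|\mathcal{N}_h^\bullet|\ge 1$, and let $\check{\mathcal{A}}$, $\check{\mathcal{B}}_{\mathrm{bd}}$ be the matrices obtained from $\mathcal{A}$, $\mathcal{B}_{\mathrm{bd}}$ by deleting the rows and columns of the first block ($u$-variables) that correspond to the nodes in $\mathcal{N}_h^\bullet$. Then the extreme eigenvalues of the preconditioned truncated operator are bounded by those of the preconditioned untruncated operator: $$\lambda_{\min}(\check{\mathcal{B}}_{\mathrm{bd}}^{-1}\check{\mathcal{A}})\ \ge\ \lambda_{\min}(\mathcal{B}_{\mathrm{bd}}^{-1}\mathcal{A}),\qquad \lambda_{\max}(\check{\mathcal{B}}_{\mathrm{bd}}^{-1}\check{\mathcal{A}})\ \le\ \lambda_{\max}(\mathcal{B}_{\mathrm{bd}}^{-1}\mathcal{A}).$$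
   Context: Let $\Omega=(0,1)\times(0,1)$, let $\mathcal{T}_h$ be a triangulation of $\Omega$ with node set $\mathcal{N}_h$, and let $(\lambda_p)_{p\in\mathcal{N}_h}$ be the nodal basis of the space of continuous functions on $\bar\Omega$ that are linear on each triangle (no boundary conditions imposed). The mass matrix is $M=(\int_\Omega \lambda_p\lambda_q\,dx)_{p,q}$, the stiffness matrix is $K=(\int_\Omega \nabla\lambda_p\cdot\nabla\lambda_q\,dx)_{p,q}$, $m=(\int_\Omega\lambda_p\,dx)_p\in\mathbb{R}^n$, and $\bar K=K+mm^T$. The parameter is $\eta=\epsilon\tau>0$. $\lambda_{\min}$ and $\lambda_{\max}$ denote the smallest and largest (signed, real) eigenvalues. Restricting to the compressed matrices $\check{\mathcal{A}},\check{\mathcal{B}}_{\mathrm{bd}}$ discards the zero rows and columns created by truncation. *)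

theory Defs
  imports
    "HOL-Analysis.Polytope"
    "HOL-Analysis.Henstock_Kurzweil_Integration"
    "Jordan_Normal_Form.Spectral_Radius"
    "Jordan_Normal_Form.Gauss_Jordan_Elimination"
    "Jordan_Normal_Form.DL_Submatrix"
begin

(* HOL-Analysis and Jordan_Normal_Form both provide vec, mat, ($) and so on. Matrices and vectors
   below are those of Jordan_Normal_Form; their sizes are terms, so no type has to be chosen for
   the number of nodes. *)
no_notation Finite_Cartesian_Product.vec_nth (infixl \<open>$\<close> 90)

definition Omega :: "(real \<times> real) set" where
  "Omega = {0<..<1} \<times> {0<..<1}"

(* The condition triangulation T contains conformity: the intersection of two members is a
   (possibly empty) common face. *)
definition triangulation_of_Omega :: "(real \<times> real) set set \<Rightarrow> bool" where
  "triangulation_of_Omega T \<longleftrightarrow>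
     triangulation T \<and> (\<forall>t\<in>T. 2 simplex t) \<and> \<Union>T = closure Omega"

definition nodes :: "(real \<times> real) set set \<Rightarrow> (real \<times> real) set" where
  "nodes T = {p. \<exists>t\<in>T. p extreme_point_of t}"

definition fe_space :: "(real \<times> real) set set \<Rightarrow> (real \<times> real \<Rightarrow> real) set" where
  "fe_space T =
     {f. continuous_on (closure Omega) f \<and> (\<forall>t\<in>T. \<exists>a c. \<forall>x\<in>t. f x = a \<bullet> x + c)}"

(* These conditions determine each basis function on the closure of Omega. Its values elsewhere
   are irrelevant, since all integrals and gradients are taken over the open set Omega. *)
definition nodal_basis ::
  "(real \<times> real) set set \<Rightarrow> (real \<times> real \<Rightarrow> real \<times> real \<Rightarrow> real) \<Rightarrow> bool" where
  "nodal_basis T lam \<longleftrightarrow>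
     (\<forall>p\<in>nodes T. lam p \<in> fe_space T \<and>
        (\<forall>q\<in>nodes T. lam p q = (if q = p then 1 else 0)))"

(* The classical pointwise gradient. For functions in fe_space T it exists in the interior of every
   triangle, hence almost everywhere in Omega, and agrees there with the weak gradient. *)
definition gradient :: "('a::real_inner \<Rightarrow> real) \<Rightarrow> 'a \<Rightarrow> 'a" where
  "gradient f x = (THE D. GDERIV f x :> D)"

(* The list ns is an enumeration of the nodes; it fixes the numbering of rows and columns. *)

definition mass_matrix ::
  "(real \<times> real \<Rightarrow> real \<times> real \<Rightarrow> real) \<Rightarrow> (real \<times> real) list \<Rightarrow> real Matrix.mat" where
  "mass_matrix lam ns = Matrix.mat (length ns) (length ns)
     (\<lambda>(i, j). integral Omega (\<lambda>x. lam (ns ! i) x * lam (ns ! j) x))"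

definition stiffness_matrix ::
  "(real \<times> real \<Rightarrow> real \<times> real \<Rightarrow> real) \<Rightarrow> (real \<times> real) list \<Rightarrow> real Matrix.mat" where
  "stiffness_matrix lam ns = Matrix.mat (length ns) (length ns)
     (\<lambda>(i, j). integral Omega (\<lambda>x. gradient (lam (ns ! i)) x \<bullet> gradient (lam (ns ! j)) x))"

definition mean_vector ::
  "(real \<times> real \<Rightarrow> real \<times> real \<Rightarrow> real) \<Rightarrow> (real \<times> real) list \<Rightarrow> real Matrix.vec" where
  "mean_vector lam ns = Matrix.vec (length ns) (\<lambda>i. integral Omega (lam (ns ! i)))"

definition Kbar ::
  "(real \<times> real \<Rightarrow> real \<times> real \<Rightarrow> real) \<Rightarrow> (real \<times> real) list \<Rightarrow> real Matrix.mat" where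
  "Kbar lam ns = stiffness_matrix lam ns +
     Matrix.mat (length ns) (length ns)
       (\<lambda>(i, j). mean_vector lam ns $ i * mean_vector lam ns $ j)"

definition saddle_matrix ::
  "real \<Rightarrow> (real \<times> real \<Rightarrow> real \<times> real \<Rightarrow> real) \<Rightarrow> (real \<times> real) list \<Rightarrow> real Matrix.mat" where
  "saddle_matrix \<eta> lam ns =
     four_block_mat
       (Kbar lam ns)        (mass_matrix lam ns)
       (mass_matrix lam ns) ((- \<eta>) \<cdot>\<^sub>m Kbar lam ns)"

definition bd_preconditioner ::
  "real \<Rightarrow> (real \<times> real \<Rightarrow> real \<times> real \<Rightarrow> real) \<Rightarrow> (real \<times> real) list \<Rightarrow> real Matrix.mat" where
  "bd_preconditioner \<eta> lam ns =
     four_block_mat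
       (Kbar lam ns + (\<eta> powr (- 1/2)) \<cdot>\<^sub>m mass_matrix lam ns)
       (0\<^sub>m (length ns) (length ns))
       (0\<^sub>m (length ns) (length ns))
       (\<eta> \<cdot>\<^sub>m Kbar lam ns + (\<eta> powr (1/2)) \<cdot>\<^sub>m mass_matrix lam ns)"

(* Rows and columns 0, ..., length ns - 1 form the first block. *)
definition truncate_mat ::
  "(real \<times> real) list \<Rightarrow> (real \<times> real) set \<Rightarrow> real Matrix.mat \<Rightarrow> real Matrix.mat" where
  "truncate_mat ns X A =
     (let kept = {0..<2 * length ns} - {i. i < length ns \<and> ns ! i \<in> X}
      in submatrix A kept kept)"

definition inv_mat :: "real Matrix.mat \<Rightarrow> real Matrix.mat" where
  "inv_mat B = the (mat_inverse B)"

definition lambda_min :: "real Matrix.mat \<Rightarrow> real" where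
  "lambda_min A = Min (spectrum A)"

definition lambda_max :: "real Matrix.mat \<Rightarrow> real" where
  "lambda_max A = Max (spectrum A)"

end

theory Submission
  imports Defs "HOL-Analysis.Equivalence_Lebesgue_Henstock_Integration"
begin

text \<open>
  Both preconditioned operators have the form $B^{-1}A$ with $A$ symmetric and $B$ symmetric
  positive definite, so their eigenvalues are the critical values of the Rayleigh quotient
  $x^T A x / x^T B x$, and the extreme eigenvalues are its minimum and maximum. Truncation deletes
  the same rows and columns from $A$ and $B$, so the truncated Rayleigh quotient is the original
  one restricted to the vectors that vanish on the deleted coordinates. The extrema over this
  smaller set lie between the extrema over the whole space. At least one coordinate survives,
  because the second block is not truncated, so the truncated operator has eigenvalues.

  The first ingredient is therefore that the extrema of the Rayleigh quotient bound it on the whole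
  space and are eigenvalues (\<open>pencil_top_eigenvalue\<close>, \<open>pencil_bottom_eigenvalue\<close>). The proof
  avoids compactness of the unit sphere: if $\mu$ is the least number for which $\mu B - A$ is
  positive semidefinite, this matrix must be singular, because an invertible positive
  semidefinite matrix is bounded below by a multiple of the identity
  (\<open>invertible_pos_semidef_coercive\<close>), which would leave room to decrease $\mu$. A kernel vector
  is then an eigenvector of $B^{-1}A$ for $\mu$. The second ingredient is the extension by zero
  (\<open>quadratic_form_submatrix\<close>); together they give \<open>pencil_extreme_eigenvalues_submatrix\<close>.

  It remains to see that the block diagonal preconditioner is positive definite. The mass
  matrix is the Gram matrix of the nodal basis in $L^2(\Omega)$, and it is definite because a
  continuous function with vanishing $L^2$ norm vanishes at the nodes, where its values are the
  coefficients. The stiffness matrix is the Gram matrix of the gradients, hence semidefinite once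
  the integrals are known to exist. They do since the gradients are constant inside every
  triangle and the edges are a null set. The rank one term $m m^T$ is a square.
\<close>

(* The infix dot below is the scalar product of vectors of term-level size. *)
no_notation inner (infix \<open>\<bullet>\<close> 70)

section \<open>Definite symmetric matrices\<close>

definition pos_def :: "nat \<Rightarrow> real Matrix.mat \<Rightarrow> bool" where
  "pos_def n B \<longleftrightarrow> B \<in> carrier_mat n n \<and> transpose_mat B = B \<and>
     (\<forall>x\<in>carrier_vec n. x \<noteq> 0\<^sub>v n \<longrightarrow> 0 < x \<bullet> (B *\<^sub>v x))"

definition pos_semidef :: "nat \<Rightarrow> real Matrix.mat \<Rightarrow> bool" where
  "pos_semidef n K \<longleftrightarrow> K \<in> carrier_mat n n \<and> transpose_mat K = K \<and>
     (\<forall>x\<in>carrier_vec n. 0 \<le> x \<bullet> (K *\<^sub>v x))"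

lemma self_scalar_prod_nonneg: "0 \<le> x \<bullet> (x :: real Matrix.vec)"
  by (simp add: scalar_prod_def sum_nonneg)

lemma scalar_prod_mult_mat_vec_eq_sum:
  assumes "A \<in> carrier_mat n n" "x \<in> carrier_vec n" "y \<in> carrier_vec n"
  shows "x \<bullet> (A *\<^sub>v y) = (\<Sum>i<n. \<Sum>j<n. x $ i * y $ j * (A $$ (i, j) :: real))"
  using assms
  by (auto simp: scalar_prod_def sum_distrib_left mult_ac atLeast0LessThan intro!: sum.cong)

lemma smult_mat_mult_vec:
  assumes "A \<in> carrier_mat n n" "v \<in> carrier_vec n"
  shows "(c \<cdot>\<^sub>m A) *\<^sub>v v = (c :: real) \<cdot>\<^sub>v (A *\<^sub>v v)"
  using assms by (intro eq_vecI) auto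

lemma quadratic_form_bounded:
  assumes A: "(A :: real Matrix.mat) \<in> carrier_mat n n"
  obtains C where "C > 0" "\<And>x. x \<in> carrier_vec n \<Longrightarrow> \<bar>x \<bullet> (A *\<^sub>v x)\<bar> \<le> C * (x \<bullet> x)"
proof
  let ?C = "\<Sum>i<n. \<Sum>j<n. \<bar>A $$ (i, j)\<bar>"
  show "?C + 1 > 0" by (simp add: sum_nonneg add_nonneg_pos)
  fix x :: "real Matrix.vec" assume x: "x \<in> carrier_vec n"
  have entry: "x $ i * x $ i \<le> x \<bullet> x" if "i < n" for i
    using that x by (auto simp: scalar_prod_def intro!: member_le_sum)
  have prod: "\<bar>x $ i * x $ j\<bar> \<le> x \<bullet> x" if "i < n" "j < n" for i j
  proof -
    have "2 * \<bar>x $ i * x $ j\<bar> \<le> x $ i * x $ i + x $ j * x $ j"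
      using sum_squares_bound[of "\<bar>x $ i\<bar>" "\<bar>x $ j\<bar>"] by (simp add: abs_mult power2_eq_square)
    with entry[OF that(1)] entry[OF that(2)] show ?thesis by linarith
  qed
  have "\<bar>x \<bullet> (A *\<^sub>v x)\<bar> \<le> (\<Sum>i<n. \<Sum>j<n. \<bar>x $ i * x $ j * A $$ (i, j)\<bar>)"
    unfolding scalar_prod_mult_mat_vec_eq_sum[OF A x x]
    by (rule order_trans[OF sum_abs] sum_mono)+ simp
  also have "\<dots> \<le> (\<Sum>i<n. \<Sum>j<n. \<bar>A $$ (i, j)\<bar> * (x \<bullet> x))"
  proof (intro sum_mono)
    fix i j assume "i \<in> {..<n}" "j \<in> {..<n}"
    then show "\<bar>x $ i * x $ j * A $$ (i, j)\<bar> \<le> \<bar>A $$ (i, j)\<bar> * (x \<bullet> x)"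
      unfolding abs_mult[of "x $ i * x $ j"] mult.commute[of _ "\<bar>A $$ (i, j)\<bar>"]
      by (intro mult_left_mono prod) auto
  qed
  also have "\<dots> = ?C * (x \<bullet> x)" by (simp add: sum_distrib_right)
  also have "\<dots> \<le> (?C + 1) * (x \<bullet> x)"
    using self_scalar_prod_nonneg[of x] by (simp add: algebra_simps)
  finally show "\<bar>x \<bullet> (A *\<^sub>v x)\<bar> \<le> (?C + 1) * (x \<bullet> x)" .
qed

lemma symmetric_mat_scalar_prod:
  assumes S: "(S :: real Matrix.mat) \<in> carrier_mat n n" "transpose_mat S = S"
    and "x \<in> carrier_vec n" "y \<in> carrier_vec n"
  shows "y \<bullet> (S *\<^sub>v x) = x \<bullet> (S *\<^sub>v y)"
  using transpose_vec_mult_scalar[OF S(1) assms(3,4)] assms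
  by (metis comm_scalar_prod mult_mat_vec_carrier)

text \<open>
  A nonnegative quadratic polynomial cannot have two distinct real roots. In the degenerate case
  $c = 0$ the polynomial is affine, and being nonnegative on the whole line it is constant.
\<close>
lemma nonneg_quadratic_discriminant:
  fixes a b c :: real
  assumes nonneg: "\<And>t. 0 \<le> a + 2 * b * t + c * t\<^sup>2" and "0 \<le> c"
  shows "b\<^sup>2 \<le> a * c"
proof (cases "c = 0")
  case True
  have "b = 0"
    using nonneg[of "- (a + 1) / (2 * b)"] True by (cases "b = 0") (auto simp: field_simps)
  then show ?thesis using True by simp
next
  case False
  then show ?thesis
    using nonneg[of "- b / c"] \<open>0 \<le> c\<close> by (simp add: field_simps power2_eq_square)
qed

text \<open>
  The quadratic polynomial $t \mapsto (x + t y)^T S (x + t y)$ is nonnegative, and the claim is the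
  sign of its discriminant.
\<close>
lemma pos_semidef_Cauchy_Schwarz:
  assumes psd: "pos_semidef n S"
    and x: "x \<in> carrier_vec n" and y: "y \<in> carrier_vec n"
  shows "(x \<bullet> (S *\<^sub>v y))\<^sup>2 \<le> (x \<bullet> (S *\<^sub>v x)) * (y \<bullet> (S *\<^sub>v y))"
proof (rule nonneg_quadratic_discriminant)
  have S: "S \<in> carrier_mat n n" "transpose_mat S = S"
    using psd by (simp_all add: pos_semidef_def)
  fix t
  have Sx: "S *\<^sub>v x \<in> carrier_vec n" and Sy: "S *\<^sub>v y \<in> carrier_vec n" using S x y by auto
  have "0 \<le> (x + t \<cdot>\<^sub>v y) \<bullet> (S *\<^sub>v (x + t \<cdot>\<^sub>v y))"
    using psd x y by (simp add: pos_semidef_def)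
  also have "S *\<^sub>v (x + t \<cdot>\<^sub>v y) = S *\<^sub>v x + t \<cdot>\<^sub>v (S *\<^sub>v y)"
    using S x y by (simp add: mult_add_distrib_mat_vec mult_mat_vec)
  also have "(x + t \<cdot>\<^sub>v y) \<bullet> (S *\<^sub>v x + t \<cdot>\<^sub>v (S *\<^sub>v y)) =
      x \<bullet> (S *\<^sub>v x) + 2 * (x \<bullet> (S *\<^sub>v y)) * t + y \<bullet> (S *\<^sub>v y) * t\<^sup>2"
    using x y Sx Sy symmetric_mat_scalar_prod[OF S x y]
    by (simp add: add_scalar_prod_distrib[of _ n] scalar_prod_add_distrib[of _ n]
        power2_eq_square algebra_simps)
  finally show "0 \<le> x \<bullet> (S *\<^sub>v x) + 2 * (x \<bullet> (S *\<^sub>v y)) * t + y \<bullet> (S *\<^sub>v y) * t\<^sup>2" .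
qed (use psd y in \<open>simp add: pos_semidef_def\<close>)

lemma inv_mat_if_det_nonzero:
  assumes A: "(A :: real Matrix.mat) \<in> carrier_mat n n" and "det A \<noteq> 0"
  shows "inv_mat A \<in> carrier_mat n n" "inv_mat A * A = 1\<^sub>m n" "A * inv_mat A = 1\<^sub>m n"
proof -
  obtain W where "mat_inverse A = Some W"
    using mat_inverse(1)[OF A] det_non_zero_imp_unit[OF assms] by fastforce
  with mat_inverse(2)[OF A this]
  show "inv_mat A \<in> carrier_mat n n" "inv_mat A * A = 1\<^sub>m n" "A * inv_mat A = 1\<^sub>m n"
    by (auto simp: inv_mat_def)
qed

text \<open>
  A quantitative form of definiteness in finite dimension. With $y = S^{-1} x$, the Cauchy-Schwarz
  inequality for the form $S$ reads
  $(x^T x)^2 = (x^T S y)^2 \le (x^T S x)(y^T S y) = (x^T S x)(x^T S^{-1} x)$, and the last factor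
  is at most a constant times $x^T x$.
\<close>
lemma invertible_pos_semidef_coercive:
  assumes psd: "pos_semidef n S" and det: "det S \<noteq> 0"
  obtains C where "C > 0" "\<And>x. x \<in> carrier_vec n \<Longrightarrow> x \<bullet> x \<le> C * (x \<bullet> (S *\<^sub>v x))"
proof -
  have S: "S \<in> carrier_mat n n" and nonneg: "\<And>x. x \<in> carrier_vec n \<Longrightarrow> 0 \<le> x \<bullet> (S *\<^sub>v x)"
    using psd by (simp_all add: pos_semidef_def)
  note W = inv_mat_if_det_nonzero[OF S det]
  obtain C where C: "C > 0" "\<And>x. x \<in> carrier_vec n \<Longrightarrow> \<bar>x \<bullet> (inv_mat S *\<^sub>v x)\<bar> \<le> C * (x \<bullet> x)"
    using quadratic_form_bounded[OF W(1)] by metis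
  have "x \<bullet> x \<le> C * (x \<bullet> (S *\<^sub>v x))" if x: "x \<in> carrier_vec n" for x
  proof (cases "x \<bullet> x = 0")
    case True
    then show ?thesis using C(1) nonneg[OF x] by simp
  next
    case False
    then have pos: "x \<bullet> x > 0" using self_scalar_prod_nonneg[of x] by simp
    define y where "y = inv_mat S *\<^sub>v x"
    have y: "y \<in> carrier_vec n" unfolding y_def using W(1) x by auto
    have Sy: "S *\<^sub>v y = x"
      unfolding y_def using W S x by (simp flip: assoc_mult_mat_vec)
    have "(x \<bullet> x)\<^sup>2 \<le> (x \<bullet> (S *\<^sub>v x)) * (y \<bullet> x)"
      using pos_semidef_Cauchy_Schwarz[OF psd x y] by (simp add: Sy)
    also have "\<dots> \<le> (x \<bullet> (S *\<^sub>v x)) * (C * (x \<bullet> x))"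
      using C(2)[OF x] comm_scalar_prod[OF x y] nonneg[OF x]
      by (intro mult_left_mono) (auto simp: y_def)
    finally have "(x \<bullet> x) * (x \<bullet> x) \<le> (C * (x \<bullet> (S *\<^sub>v x))) * (x \<bullet> x)"
      by (simp add: power2_eq_square mult_ac)
    with pos show ?thesis by (simp only: mult_le_cancel_right)
  qed
  with C(1) that show ?thesis by blast
qed

lemma pos_def_imp_pos_semidef:
  assumes "pos_def n B"
  shows "pos_semidef n B"
proof -
  have "0 \<le> x \<bullet> (B *\<^sub>v x)" if "x \<in> carrier_vec n" for x
    using assms that by (cases "x = 0\<^sub>v n") (auto simp: pos_def_def intro: less_imp_le)
  then show ?thesis using assms by (simp add: pos_def_def pos_semidef_def)
qed

lemma pos_def_det_nonzero:
  assumes "pos_def n B"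
  shows "det B \<noteq> 0"
proof
  assume "det B = 0"
  then obtain v where v: "v \<in> carrier_vec n" "v \<noteq> 0\<^sub>v n" "B *\<^sub>v v = 0\<^sub>v n"
    using assms det_0_iff_vec_prod_zero_field[of B n] by (auto simp: pos_def_def)
  then show False using assms by (fastforce simp: pos_def_def)
qed

section \<open>Extreme eigenvalues of a symmetric definite pencil\<close>

lemma eigenvector_pencil_iff:
  assumes B: "pos_def n B" and A: "A \<in> carrier_mat n n" and v: "v \<in> carrier_vec n"
  shows "inv_mat B *\<^sub>v (A *\<^sub>v v) = k \<cdot>\<^sub>v v \<longleftrightarrow> A *\<^sub>v v = k \<cdot>\<^sub>v (B *\<^sub>v v)"
proof -
  have Bc: "B \<in> carrier_mat n n" using B by (simp add: pos_def_def)
  note W = inv_mat_if_det_nonzero[OF Bc pos_def_det_nonzero[OF B]]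
  have Av: "A *\<^sub>v v \<in> carrier_vec n" using A v by auto
  have 1: "B *\<^sub>v (inv_mat B *\<^sub>v (A *\<^sub>v v)) = A *\<^sub>v v"
    using W Bc Av by (simp flip: assoc_mult_mat_vec)
  have 2: "inv_mat B *\<^sub>v (B *\<^sub>v v) = v"
    using W Bc v by (simp flip: assoc_mult_mat_vec)
  show ?thesis
    using 1 2 mult_mat_vec[OF Bc v, of k] mult_mat_vec[OF W(1), of "B *\<^sub>v v" k] Bc v
    by (metis mult_mat_vec_carrier)
qed

lemma mem_spectrum_pencil:
  assumes B: "pos_def n B" and A: "A \<in> carrier_mat n n"
  shows "k \<in> spectrum (inv_mat B * A) \<longleftrightarrow>
    (\<exists>v\<in>carrier_vec n. v \<noteq> 0\<^sub>v n \<and> A *\<^sub>v v = k \<cdot>\<^sub>v (B *\<^sub>v v))"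
proof -
  have Bc: "B \<in> carrier_mat n n" using B by (simp add: pos_def_def)
  note W = inv_mat_if_det_nonzero[OF Bc pos_def_det_nonzero[OF B]]
  have "inv_mat B * A *\<^sub>v v = inv_mat B *\<^sub>v (A *\<^sub>v v)" if "v \<in> carrier_vec n" for v
    using W A that by auto
  then have "(inv_mat B * A *\<^sub>v v = k \<cdot>\<^sub>v v) = (A *\<^sub>v v = k \<cdot>\<^sub>v (B *\<^sub>v v))"
    if "v \<in> carrier_vec n" for v
    using eigenvector_pencil_iff[OF B A that, of k] that by simp
  then show ?thesis
    using W(1) unfolding spectrum_def eigenvalue_def eigenvector_def by auto
qed

lemma pencil_eigenvalue_is_Rayleigh_quotient:
  assumes B: "pos_def n B" and A: "A \<in> carrier_mat n n"
    and k: "k \<in> spectrum (inv_mat B * A)"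
  obtains v where "v \<in> carrier_vec n" "0 < v \<bullet> (B *\<^sub>v v)" "v \<bullet> (A *\<^sub>v v) = k * (v \<bullet> (B *\<^sub>v v))"
proof -
  obtain v where v: "v \<in> carrier_vec n" "v \<noteq> 0\<^sub>v n" "A *\<^sub>v v = k \<cdot>\<^sub>v (B *\<^sub>v v)"
    using k mem_spectrum_pencil[OF B A] by blast
  have "v \<bullet> (A *\<^sub>v v) = k * (v \<bullet> (B *\<^sub>v v))"
    unfolding v(3) using v(1) B by (intro scalar_prod_smult_distrib) (auto simp: pos_def_def)
  then show ?thesis using that[of v] v B by (simp add: pos_def_def)
qed

text \<open>
  The eigenvalue $\mu$ is the infimum of the set $G$ of all $t$ such that $t B - A$ is positive
  semidefinite. The infimum is attained, and $\mu B - A$ is singular: otherwise it would dominate a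
  positive multiple of $B$, and $G$ would contain a number below $\mu$.
\<close>
lemma pencil_top_eigenvalue:
  assumes B: "pos_def n B" and A: "A \<in> carrier_mat n n" "transpose_mat A = A" and n: "n > 0"
  obtains \<mu> where "\<mu> \<in> spectrum (inv_mat B * A)"
    "\<And>x. x \<in> carrier_vec n \<Longrightarrow> x \<bullet> (A *\<^sub>v x) \<le> \<mu> * (x \<bullet> (B *\<^sub>v x))"
proof -
  have Bc: "B \<in> carrier_mat n n" and Bt: "transpose_mat B = B"
    and Bpos: "\<And>x. x \<in> carrier_vec n \<Longrightarrow> x \<noteq> 0\<^sub>v n \<Longrightarrow> 0 < x \<bullet> (B *\<^sub>v x)"
    using B by (auto simp: pos_def_def)
  define G where "G = {t. \<forall>x\<in>carrier_vec n. x \<bullet> (A *\<^sub>v x) \<le> t * (x \<bullet> (B *\<^sub>v x))}"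
  define \<mu> where "\<mu> = Inf G"
  obtain a where a: "a > 0" "\<And>x. x \<in> carrier_vec n \<Longrightarrow> \<bar>x \<bullet> (A *\<^sub>v x)\<bar> \<le> a * (x \<bullet> x)"
    using quadratic_form_bounded[OF A(1)] by metis
  obtain b where b: "b > 0" "\<And>x. x \<in> carrier_vec n \<Longrightarrow> \<bar>x \<bullet> (B *\<^sub>v x)\<bar> \<le> b * (x \<bullet> x)"
    using quadratic_form_bounded[OF Bc] by metis
  obtain c where c: "c > 0" "\<And>x. x \<in> carrier_vec n \<Longrightarrow> x \<bullet> x \<le> c * (x \<bullet> (B *\<^sub>v x))"
    using invertible_pos_semidef_coercive[OF pos_def_imp_pos_semidef[OF B] pos_def_det_nonzero[OF B]]
    by metis
  (* G contains large t since B dominates a multiple of the identity and A is dominated by one. *)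
  have "a * c \<in> G"
    unfolding G_def
  proof (clarify)
    fix x :: "real Matrix.vec" assume x: "x \<in> carrier_vec n"
    have "x \<bullet> (A *\<^sub>v x) \<le> a * (x \<bullet> x)" using a(2)[OF x] by linarith
    also have "\<dots> \<le> a * (c * (x \<bullet> (B *\<^sub>v x)))" using a(1) c(2)[OF x] by (intro mult_left_mono) auto
    finally show "x \<bullet> (A *\<^sub>v x) \<le> a * c * (x \<bullet> (B *\<^sub>v x))" by (simp add: mult_ac)
  qed
  then have nonempty: "G \<noteq> {}" by blast
  have below: "x \<bullet> (A *\<^sub>v x) / (x \<bullet> (B *\<^sub>v x)) \<le> t"
    if "t \<in> G" "x \<in> carrier_vec n" "x \<noteq> 0\<^sub>v n" for t x
    using that Bpos[of x] by (auto simp: G_def divide_le_eq)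
  (* Any nonzero vector bounds G from below by its Rayleigh quotient. *)
  have "unit_vec n 0 \<noteq> (0\<^sub>v n :: real Matrix.vec)" using n by simp
  then have bdd: "bdd_below G"
    using below[of _ "unit_vec n 0"] by (auto simp: bdd_below_def)
  have \<mu>: "x \<bullet> (A *\<^sub>v x) \<le> \<mu> * (x \<bullet> (B *\<^sub>v x))" if x: "x \<in> carrier_vec n" for x
  proof (cases "x = 0\<^sub>v n")
    case True
    then show ?thesis using A Bc by simp
  next
    case False
    have "x \<bullet> (A *\<^sub>v x) / (x \<bullet> (B *\<^sub>v x)) \<le> \<mu>"
      unfolding \<mu>_def using nonempty below[OF _ x False] by (rule cInf_greatest)
    then show ?thesis using Bpos[OF x False] by (simp add: divide_le_eq)
  qed
  define S where "S = \<mu> \<cdot>\<^sub>m B - A"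
  have S: "S \<in> carrier_mat n n" "transpose_mat S = S"
  proof -
    show "S \<in> carrier_mat n n" unfolding S_def by (rule minus_carrier_mat[OF A(1)])
    have "transpose_mat (\<mu> \<cdot>\<^sub>m B) = \<mu> \<cdot>\<^sub>m transpose_mat B" by auto
    then show "transpose_mat S = S"
      using A Bt by (simp add: S_def transpose_minus[OF smult_carrier_mat[OF Bc] A(1)])
  qed
  have Sv: "S *\<^sub>v x = \<mu> \<cdot>\<^sub>v (B *\<^sub>v x) - A *\<^sub>v x" if "x \<in> carrier_vec n" for x
    unfolding S_def using A Bc that
    by (simp add: minus_mult_distrib_mat_vec[of _ n n] smult_mat_mult_vec)
  have Sform: "x \<bullet> (S *\<^sub>v x) = \<mu> * (x \<bullet> (B *\<^sub>v x)) - x \<bullet> (A *\<^sub>v x)" if "x \<in> carrier_vec n" for x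
    using that A Bc by (simp add: Sv scalar_prod_minus_distrib[of _ n])
  have "det S = 0"
  proof (rule ccontr)
    assume "det S \<noteq> 0"
    then obtain s where s: "s > 0" "\<And>x. x \<in> carrier_vec n \<Longrightarrow> x \<bullet> x \<le> s * (x \<bullet> (S *\<^sub>v x))"
      using invertible_pos_semidef_coercive[of n S] S Sform \<mu> unfolding pos_semidef_def
      by (metis diff_ge_0_iff_ge)
    (* B is at most b times the identity, and the identity at most s times S, so S - B / (b s) is
       still semidefinite. *)
    have "\<mu> - 1 / (b * s) \<in> G"
      unfolding G_def
    proof (clarify)
      fix x :: "real Matrix.vec" assume x: "x \<in> carrier_vec n"
      have "x \<bullet> (B *\<^sub>v x) \<le> b * (x \<bullet> x)" using b(2)[OF x] by linarith
      also have "\<dots> \<le> b * (s * (x \<bullet> (S *\<^sub>v x)))"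
        using b(1) s(2)[OF x] by (intro mult_left_mono) auto
      finally have "x \<bullet> (B *\<^sub>v x) / (b * s) \<le> x \<bullet> (S *\<^sub>v x)"
        using b(1) s(1) by (simp add: divide_le_eq mult_ac)
      then show "x \<bullet> (A *\<^sub>v x) \<le> (\<mu> - 1 / (b * s)) * (x \<bullet> (B *\<^sub>v x))"
        unfolding Sform[OF x] by (simp add: algebra_simps)
    qed
    then have "\<mu> \<le> \<mu> - 1 / (b * s)" unfolding \<mu>_def by (rule cInf_lower[OF _ bdd])
    with b(1) s(1) show False by (simp add: field_simps)
  qed
  then obtain v where v: "v \<in> carrier_vec n" "v \<noteq> 0\<^sub>v n" "S *\<^sub>v v = 0\<^sub>v n"
    using det_0_iff_vec_prod_zero_field[OF S(1)] by blast
  have "A *\<^sub>v v = \<mu> \<cdot>\<^sub>v (B *\<^sub>v v)"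
  proof (rule eq_vecI)
    fix i assume "i < dim_vec (\<mu> \<cdot>\<^sub>v (B *\<^sub>v v))"
    then have i: "i < n" using Bc by auto
    then have "(\<mu> \<cdot>\<^sub>v (B *\<^sub>v v) - A *\<^sub>v v) $ i = 0" using v Sv[OF v(1)] by simp
    then show "(A *\<^sub>v v) $ i = (\<mu> \<cdot>\<^sub>v (B *\<^sub>v v)) $ i" using i A Bc by simp
  qed (use A Bc in auto)
  then have "\<mu> \<in> spectrum (inv_mat B * A)"
    using mem_spectrum_pencil[OF B A(1)] v by blast
  with \<mu> that show ?thesis by blast
qed

text \<open>
  The top eigenvalue for $- A$ is the negative of the bottom eigenvalue for $A$.
\<close>
lemma pencil_bottom_eigenvalue:
  assumes B: "pos_def n B" and A: "A \<in> carrier_mat n n" "transpose_mat A = A" and n: "n > 0"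
  obtains \<mu> where "\<mu> \<in> spectrum (inv_mat B * A)"
    "\<And>x. x \<in> carrier_vec n \<Longrightarrow> \<mu> * (x \<bullet> (B *\<^sub>v x)) \<le> x \<bullet> (A *\<^sub>v x)"
proof -
  have Bc: "B \<in> carrier_mat n n" using B by (simp add: pos_def_def)
  have mA: "- A \<in> carrier_mat n n" "transpose_mat (- A) = - A"
    using A by (auto simp: transpose_uminus)
  obtain \<mu> where \<mu>: "\<mu> \<in> spectrum (inv_mat B * - A)"
    "\<And>x. x \<in> carrier_vec n \<Longrightarrow> x \<bullet> (- A *\<^sub>v x) \<le> \<mu> * (x \<bullet> (B *\<^sub>v x))"
    using pencil_top_eigenvalue[OF B mA n] by metis
  obtain v where v: "v \<in> carrier_vec n" "v \<noteq> 0\<^sub>v n" "- A *\<^sub>v v = \<mu> \<cdot>\<^sub>v (B *\<^sub>v v)"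
    using \<mu>(1) mem_spectrum_pencil[OF B mA(1)] by blast
  have "A *\<^sub>v v = (- \<mu>) \<cdot>\<^sub>v (B *\<^sub>v v)"
  proof (rule eq_vecI)
    fix i assume "i < dim_vec ((- \<mu>) \<cdot>\<^sub>v (B *\<^sub>v v))"
    then have i: "i < n" using Bc by auto
    have "(- A *\<^sub>v v) $ i = (\<mu> \<cdot>\<^sub>v (B *\<^sub>v v)) $ i" by (simp add: v(3))
    then show "(A *\<^sub>v v) $ i = ((- \<mu>) \<cdot>\<^sub>v (B *\<^sub>v v)) $ i"
      using i A Bc v(1) by simp
  qed (use A Bc in auto)
  then have "- \<mu> \<in> spectrum (inv_mat B * A)"
    using mem_spectrum_pencil[OF B A(1)] v by blast
  moreover have "- \<mu> * (x \<bullet> (B *\<^sub>v x)) \<le> x \<bullet> (A *\<^sub>v x)" if x: "x \<in> carrier_vec n" for x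
    using \<mu>(2)[OF x] x A by simp
  ultimately show ?thesis using that by blast
qed

section \<open>Compression to a principal submatrix\<close>

text \<open>
  The coordinates of a vector indexed by the positions within \<open>I\<close> are placed at the members of
  \<open>I\<close>; the number of smaller members is the position of a member and so inverts \<open>pick I\<close>.
\<close>
definition zero_extension :: "nat \<Rightarrow> nat set \<Rightarrow> real Matrix.vec \<Rightarrow> real Matrix.vec" where
  "zero_extension n I v =
     Matrix.vec n (\<lambda>i. if i \<in> I then v $ card {a \<in> I. a < i} else 0)"

lemma zero_extension_carrier: "zero_extension n I v \<in> carrier_vec n"
  by (simp add: zero_extension_def)

lemma bij_betw_pick:
  assumes "finite I"
  shows "bij_betw (pick I) {..<card I} I"
proof (rule bij_betw_byWitness[where f' = "\<lambda>i. card {a \<in> I. a < i}"])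
  show "(\<lambda>i. card {a \<in> I. a < i}) ` I \<subseteq> {..<card I}"
    using assms by (auto intro!: psubset_card_mono)
qed (use pick_in_set_le[of _ I] card_pick[of _ I] pick_card_in_set[of _ I] in auto)

lemma zero_extension_pick:
  assumes "I \<subseteq> {..<n}" "k < card I"
  shows "zero_extension n I v $ pick I k = v $ k"
  using pick_in_set_le[OF assms(2)] assms card_pick[of k I]
  by (auto simp: zero_extension_def)

lemma submatrix_eq_mat:
  assumes "A \<in> carrier_mat n n" "I \<subseteq> {..<n}"
  shows "submatrix A I I = Matrix.mat (card I) (card I) (\<lambda>(i, j). A $$ (pick I i, pick I j))"
proof -
  have "{i. i < n \<and> i \<in> I} = I" using assms by auto
  then show ?thesis using assms by (simp add: submatrix_def)
qed

text \<open>
  Summands with an index outside \<open>I\<close> vanish, and \<open>pick I\<close> renumbers the remaining ones. This is what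
  makes a truncated Rayleigh quotient a restriction of the original one.
\<close>
lemma quadratic_form_submatrix:
  assumes A: "(A :: real Matrix.mat) \<in> carrier_mat n n" and I: "I \<subseteq> {..<n}"
    and v: "v \<in> carrier_vec (card I)"
  shows "v \<bullet> (submatrix A I I *\<^sub>v v) =
    zero_extension n I v \<bullet> (A *\<^sub>v zero_extension n I v)"
proof -
  let ?E = "zero_extension n I v"
  have sub: "submatrix A I I \<in> carrier_mat (card I) (card I)"
    by (simp add: submatrix_eq_mat[OF A I])
  have fin: "finite I" using I finite_subset by blast
  have restrict: "(\<Sum>i<n. ?E $ i * g i) = (\<Sum>k<card I. v $ k * g (pick I k))" for g
  proof -
    have "(\<Sum>i<n. ?E $ i * g i) = (\<Sum>i\<in>I. ?E $ i * g i)"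
      by (rule sum.mono_neutral_right) (use I in \<open>auto simp: zero_extension_def\<close>)
    also have "\<dots> = (\<Sum>k<card I. ?E $ pick I k * g (pick I k))"
      by (rule sum.reindex_bij_betw[OF bij_betw_pick[OF fin], symmetric])
    finally show ?thesis by (simp add: zero_extension_pick[OF I])
  qed
  have "?E \<bullet> (A *\<^sub>v ?E) = (\<Sum>i<n. ?E $ i * (\<Sum>j<n. ?E $ j * A $$ (i, j)))"
    by (simp add: scalar_prod_mult_mat_vec_eq_sum[OF A zero_extension_carrier zero_extension_carrier]
        sum_distrib_left mult.assoc)
  also have "\<dots> = (\<Sum>i<card I. \<Sum>j<card I. v $ i * v $ j * A $$ (pick I i, pick I j))"
    by (subst restrict, subst restrict) (simp add: sum_distrib_left mult.assoc)
  also have "\<dots> = v \<bullet> (submatrix A I I *\<^sub>v v)"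
    unfolding scalar_prod_mult_mat_vec_eq_sum[OF sub v v] by (simp add: submatrix_eq_mat[OF A I])
  finally show ?thesis by simp
qed

lemma submatrix_symmetric:
  assumes A: "A \<in> carrier_mat n n" "transpose_mat A = A" and I: "I \<subseteq> {..<n}"
  shows "submatrix A I I \<in> carrier_mat (card I) (card I)"
    and "transpose_mat (submatrix A I I) = submatrix A I I"
proof -
  have fin: "finite I" using I finite_subset by blast
  have "A $$ (pick I j, pick I i) = A $$ (pick I i, pick I j)" if "i < card I" "j < card I" for i j
  proof -
    have "pick I i < n" "pick I j < n" using that I pick_in_set_le by blast+
    then show ?thesis using A by (metis carrier_matD index_transpose_mat(1))
  qed
  then show "transpose_mat (submatrix A I I) = submatrix A I I"
    by (auto simp: submatrix_eq_mat[OF A(1) I])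
qed (simp add: submatrix_eq_mat[OF A(1) I])

lemma pos_def_submatrix:
  assumes B: "pos_def n B" and I: "I \<subseteq> {..<n}"
  shows "pos_def (card I) (submatrix B I I)"
proof -
  have Bc: "B \<in> carrier_mat n n" and Bt: "transpose_mat B = B"
    using B by (auto simp: pos_def_def)
  have "0 < v \<bullet> (submatrix B I I *\<^sub>v v)" if v: "v \<in> carrier_vec (card I)" "v \<noteq> 0\<^sub>v (card I)" for v
  proof -
    obtain k where k: "k < card I" "v $ k \<noteq> 0"
      using v by (metis carrier_vecD eq_vecI index_zero_vec(1) index_zero_vec(2))
    have "pick I k < n" using k(1) I pick_in_set_le by blast
    then have "zero_extension n I v \<noteq> 0\<^sub>v n"
      using zero_extension_pick[OF I k(1)] k(2) by (metis index_zero_vec(1))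
    then show ?thesis
      using B quadratic_form_submatrix[OF Bc I v(1)] zero_extension_carrier[of n I v]
      by (simp add: pos_def_def)
  qed
  then show ?thesis using submatrix_symmetric[OF Bc Bt I] by (simp add: pos_def_def)
qed

text \<open>
  Every eigenvalue of the compressed pencil is the Rayleigh quotient of its eigenvector, hence also
  the original Rayleigh quotient of the zero extension of that vector, which lies between the
  bottom and the top eigenvalue of the original pencil. The set \<open>I\<close> has to be nonempty for the
  compressed pencil to have an eigenvalue at all.
\<close>
lemma pencil_extreme_eigenvalues_submatrix:
  assumes B: "pos_def n B" and A: "A \<in> carrier_mat n n" "transpose_mat A = A"
    and I: "I \<subseteq> {..<n}" "I \<noteq> {}"
  shows "lambda_min (inv_mat B * A) \<le> lambda_min (inv_mat (submatrix B I I) * submatrix A I I)"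
    and "lambda_max (inv_mat (submatrix B I I) * submatrix A I I) \<le> lambda_max (inv_mat B * A)"
proof -
  let ?A = "submatrix A I I" and ?B = "submatrix B I I"
  let ?E = "zero_extension n I"
  have Bc: "B \<in> carrier_mat n n" using B by (simp add: pos_def_def)
  have finI: "finite I" using I(1) finite_subset by blast
  have n: "n > 0" and m: "card I > 0" using I finI by (auto simp: card_gt_0_iff)
  note As = submatrix_symmetric[OF A I(1)]
  note Bs = pos_def_submatrix[OF B I(1)]
  have Bsc: "?B \<in> carrier_mat (card I) (card I)" using Bs by (simp add: pos_def_def)
  have fin: "finite (spectrum (inv_mat B * A))"
    using inv_mat_if_det_nonzero(1)[OF Bc pos_def_det_nonzero[OF B]] A(1)
    by (intro card_finite_spectrum(1)) auto
  have fins: "finite (spectrum (inv_mat ?B * ?A))"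
    using inv_mat_if_det_nonzero(1)[OF Bsc pos_def_det_nonzero[OF Bs]] As(1)
    by (intro card_finite_spectrum(1)) auto
  have ne: "spectrum (inv_mat ?B * ?A) \<noteq> {}"
    using pencil_top_eigenvalue[OF Bs As m] by blast
  obtain \<mu> where \<mu>: "\<mu> \<in> spectrum (inv_mat B * A)"
    "\<And>x. x \<in> carrier_vec n \<Longrightarrow> x \<bullet> (A *\<^sub>v x) \<le> \<mu> * (x \<bullet> (B *\<^sub>v x))"
    using pencil_top_eigenvalue[OF B A n] by metis
  obtain \<nu> where \<nu>: "\<nu> \<in> spectrum (inv_mat B * A)"
    "\<And>x. x \<in> carrier_vec n \<Longrightarrow> \<nu> * (x \<bullet> (B *\<^sub>v x)) \<le> x \<bullet> (A *\<^sub>v x)"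
    using pencil_bottom_eigenvalue[OF B A n] by metis
  have bounds: "\<nu> \<le> k \<and> k \<le> \<mu>" if k: "k \<in> spectrum (inv_mat ?B * ?A)" for k
  proof -
    obtain v where v: "v \<in> carrier_vec (card I)" "0 < v \<bullet> (?B *\<^sub>v v)"
      "v \<bullet> (?A *\<^sub>v v) = k * (v \<bullet> (?B *\<^sub>v v))"
      using pencil_eigenvalue_is_Rayleigh_quotient[OF Bs As(1) k] by metis
    have eq: "?E v \<bullet> (A *\<^sub>v ?E v) = k * (?E v \<bullet> (B *\<^sub>v ?E v))" and pos: "0 < ?E v \<bullet> (B *\<^sub>v ?E v)"
      using v quadratic_form_submatrix[OF A(1) I(1) v(1)] quadratic_form_submatrix[OF Bc I(1) v(1)]
      by auto
    show ?thesis
      using \<mu>(2)[of "?E v"] \<nu>(2)[of "?E v"] zero_extension_carrier[of n I v] pos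
      by (simp add: eq)
  qed
  show "lambda_min (inv_mat B * A) \<le> lambda_min (inv_mat ?B * ?A)"
    unfolding lambda_min_def using bounds fin fins ne \<nu>(1) by (auto intro: order_trans[OF Min_le])
  show "lambda_max (inv_mat ?B * ?A) \<le> lambda_max (inv_mat B * A)"
    unfolding lambda_max_def using bounds fin fins ne \<mu>(1) by (auto intro: order_trans[OF _ Max_ge])
qed

section \<open>Sums, blocks and Gram matrices\<close>

lemma quadratic_form_add:
  assumes "(A :: real Matrix.mat) \<in> carrier_mat n n" "B \<in> carrier_mat n n" "x \<in> carrier_vec n"
  shows "x \<bullet> ((A + B) *\<^sub>v x) = x \<bullet> (A *\<^sub>v x) + x \<bullet> (B *\<^sub>v x)"
  using assms by (simp add: add_mult_distrib_mat_vec[of _ n n] scalar_prod_add_distrib[of _ n])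

lemma quadratic_form_smult:
  assumes "(A :: real Matrix.mat) \<in> carrier_mat n n" "x \<in> carrier_vec n"
  shows "x \<bullet> ((c \<cdot>\<^sub>m A) *\<^sub>v x) = c * (x \<bullet> (A *\<^sub>v x))"
  using assms by (simp add: smult_mat_mult_vec)

lemma transpose_smult_mat: "transpose_mat (c \<cdot>\<^sub>m A) = c \<cdot>\<^sub>m transpose_mat A"
  by auto

lemma pos_semidef_smult:
  assumes "pos_semidef n K" "0 \<le> c"
  shows "pos_semidef n (c \<cdot>\<^sub>m K)"
  using assms by (auto simp: pos_semidef_def quadratic_form_smult transpose_smult_mat)

lemma pos_semidef_add:
  assumes "pos_semidef n K" "pos_semidef n L"
  shows "pos_semidef n (K + L)"
  using assms by (auto simp: pos_semidef_def quadratic_form_add transpose_add)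

lemma pos_def_smult:
  assumes "pos_def n M" "0 < c"
  shows "pos_def n (c \<cdot>\<^sub>m M)"
  using assms by (auto simp: pos_def_def quadratic_form_smult transpose_smult_mat)

lemma pos_def_add_pos_semidef:
  assumes "pos_semidef n K" "pos_def n M"
  shows "pos_def n (K + M)"
  using assms
  by (auto simp: pos_semidef_def pos_def_def quadratic_form_add transpose_add add_nonneg_pos)

lemma pos_def_block_diagonal:
  assumes P: "pos_def n P" and Q: "pos_def m Q"
  shows "pos_def (n + m) (four_block_mat P (0\<^sub>m n m) (0\<^sub>m m n) Q)" (is "pos_def _ ?D")
proof -
  have Pc: "P \<in> carrier_mat n n" and Pt: "transpose_mat P = P"
    and Qc: "Q \<in> carrier_mat m m" and Qt: "transpose_mat Q = Q"
    using P Q by (auto simp: pos_def_def)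
  have "0 < x \<bullet> (?D *\<^sub>v x)" if x: "x \<in> carrier_vec (n + m)" "x \<noteq> 0\<^sub>v (n + m)" for x
  proof -
    define y where "y = vec_first x n"
    define z where "z = vec_last x m"
    have y: "y \<in> carrier_vec n" and z: "z \<in> carrier_vec m" and xyz: "x = y @\<^sub>v z"
      using x(1) by (auto simp: y_def z_def)
    have "x \<bullet> (?D *\<^sub>v x) = y \<bullet> (P *\<^sub>v y) + z \<bullet> (Q *\<^sub>v z)"
      unfolding xyz mult_mat_vec_split[OF Pc Qc y z]
      using scalar_prod_append[OF y z] Pc Qc y z by simp
    moreover have "y \<noteq> 0\<^sub>v n \<or> z \<noteq> 0\<^sub>v m"
      using x(2) by (auto simp: xyz)
    moreover have "0 \<le> y \<bullet> (P *\<^sub>v y)" "y \<noteq> 0\<^sub>v n \<Longrightarrow> 0 < y \<bullet> (P *\<^sub>v y)"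
      using P y by (cases "y = 0\<^sub>v n"; fastforce simp: pos_def_def intro: less_imp_le)+
    moreover have "0 \<le> z \<bullet> (Q *\<^sub>v z)" "z \<noteq> 0\<^sub>v m \<Longrightarrow> 0 < z \<bullet> (Q *\<^sub>v z)"
      using Q z by (cases "z = 0\<^sub>v m"; fastforce simp: pos_def_def intro: less_imp_le)+
    ultimately show ?thesis by force
  qed
  then show ?thesis
    using Pc Qc by (auto simp: pos_def_def transpose_four_block_mat[of _ n n _ m _ m] Pt Qt)
qed

text \<open>
  Integrability of all the products is essential here: the integral of a function that is not
  integrable is 0 by convention, so integration is additive only on integrable functions.
\<close>
lemma Gram_quadratic_form:
  fixes g :: "nat \<Rightarrow> 'a::euclidean_space \<Rightarrow> 'b::real_inner"
  assumes int: "\<And>i j. i < n \<Longrightarrow> j < n \<Longrightarrow> (\<lambda>y. inner (g i y) (g j y)) integrable_on S"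
    and x: "x \<in> carrier_vec n"
  shows "x \<bullet> (Matrix.mat n n (\<lambda>(i, j). integral S (\<lambda>y. inner (g i y) (g j y))) *\<^sub>v x) =
    integral S (\<lambda>y. (norm (\<Sum>i<n. (x $ i) *\<^sub>R g i y))\<^sup>2)" (is "?l = ?r")
proof -
  let ?h = "\<lambda>i j y. x $ i * x $ j * inner (g i y) (g j y)"
  have int': "?h i j integrable_on S" if "i < n" "j < n" for i j
    using int[OF that] by (rule integrable_on_mult_right)
  have "?l = (\<Sum>i<n. \<Sum>j<n. integral S (?h i j))"
    by (subst scalar_prod_mult_mat_vec_eq_sum[OF _ x x]) auto
  also have "\<dots> = (\<Sum>i<n. integral S (\<lambda>y. \<Sum>j<n. ?h i j y))"
    by (intro sum.cong refl integral_sum[symmetric]) (use int' in auto)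
  also have "\<dots> = integral S (\<lambda>y. \<Sum>i<n. \<Sum>j<n. ?h i j y)"
    by (intro integral_sum[symmetric] integrable_sum) (use int' in auto)
  also have "\<dots> = ?r"
    unfolding power2_norm_eq_inner inner_sum_left unfolding inner_sum_right
    by (simp add: mult_ac)
  finally show ?thesis .
qed

lemma Gram_symmetric:
  fixes g :: "nat \<Rightarrow> 'a::euclidean_space \<Rightarrow> 'b::real_inner"
  shows "transpose_mat (Matrix.mat n n (\<lambda>(i, j). integral S (\<lambda>y. inner (g i y) (g j y)))) =
    Matrix.mat n n (\<lambda>(i, j). integral S (\<lambda>y. inner (g i y) (g j y)))"
  by (auto simp: inner_commute)

lemma pos_semidef_Gram:
  fixes g :: "nat \<Rightarrow> 'a::euclidean_space \<Rightarrow> 'b::real_inner"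
  assumes int: "\<And>i j. i < n \<Longrightarrow> j < n \<Longrightarrow> (\<lambda>y. inner (g i y) (g j y)) integrable_on S"
  shows "pos_semidef n (Matrix.mat n n (\<lambda>(i, j). integral S (\<lambda>y. inner (g i y) (g j y))))"
proof -
  have "0 \<le> integral S (\<lambda>y. (norm (\<Sum>i<n. x $ i *\<^sub>R g i y))\<^sup>2)" for x
    by (cases "(\<lambda>y. (norm (\<Sum>i<n. x $ i *\<^sub>R g i y))\<^sup>2) integrable_on S")
      (auto intro: integral_nonneg simp: not_integrable_integral)
  then show ?thesis
    unfolding pos_semidef_def Gram_symmetric
    by (auto simp: Gram_quadratic_form[where g = g, OF int])
qed

lemma pos_semidef_outer_product:
  "pos_semidef n (Matrix.mat n n (\<lambda>(i, j). w $ i * w $ j))"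
proof -
  let ?W = "Matrix.mat n n (\<lambda>(i, j). w $ i * w $ j) :: real Matrix.mat"
  have "0 \<le> x \<bullet> (?W *\<^sub>v x)" if x: "x \<in> carrier_vec n" for x
  proof -
    have "x \<bullet> (?W *\<^sub>v x) = (\<Sum>i<n. x $ i * w $ i)\<^sup>2"
      by (subst scalar_prod_mult_mat_vec_eq_sum[OF _ x x])
        (auto simp: power2_eq_square sum_product mult_ac intro!: sum.cong)
    then show ?thesis by simp
  qed
  then show ?thesis by (auto simp: pos_semidef_def)
qed

section \<open>Finite element matrices\<close>

lemma Omega_eq_box: "Omega = box (0, 0) (1, 1)"
  by (auto simp: Omega_def box_def Basis_prod_def)

lemma closure_Omega_eq_cbox: "closure Omega = cbox (0, 0) (1, 1)"
proof -
  have "(1/2, 1/2) \<in> Omega" by (simp add: Omega_def)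
  then show ?thesis unfolding Omega_eq_box by (intro closure_box) auto
qed

lemma nodes_subset_closure_Omega:
  assumes "triangulation_of_Omega T"
  shows "nodes T \<subseteq> closure Omega"
  using assms by (auto simp: nodes_def triangulation_of_Omega_def extreme_point_of_def)

text \<open>
  The quadratic form at $x$ is the squared $L^2$ norm of the finite element function with nodal
  values $x$. That function is continuous on the closed square and nonzero at some node if
  $x \neq 0$, so its norm is positive.
\<close>
lemma mass_matrix_pos_def:
  assumes T: "triangulation_of_Omega T" and ns: "distinct ns" "set ns = nodes T"
    and lam: "nodal_basis T lam"
  shows "pos_def (length ns) (mass_matrix lam ns)"
proof -
  let ?n = "length ns"
  let ?g = "\<lambda>i. lam (ns ! i)"
  have node: "ns ! i \<in> nodes T" if "i < ?n" for i using that ns by (metis nth_mem)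
  have cont: "continuous_on (cbox (0, 0) (1, 1)) (?g i)" if "i < ?n" for i
    using lam node[OF that] by (auto simp: nodal_basis_def fe_space_def closure_Omega_eq_cbox)
  have delta: "?g i (ns ! k) = (if k = i then 1 else 0)" if "i < ?n" "k < ?n" for i k
    using lam node[OF that(1)] node[OF that(2)] that ns(1)
    by (auto simp: nodal_basis_def nth_eq_iff_index_eq)
  have int: "(\<lambda>y. inner (?g i y) (?g j y)) integrable_on Omega" if "i < ?n" "j < ?n" for i j
    unfolding Omega_eq_box integrable_on_open_interval
    by (intro integrable_continuous continuous_on_inner cont that)
  have mass: "mass_matrix lam ns =
      Matrix.mat ?n ?n (\<lambda>(i, j). integral Omega (\<lambda>y. inner (?g i y) (?g j y)))"
    by (simp add: mass_matrix_def)
  have sym: "transpose_mat (mass_matrix lam ns) = mass_matrix lam ns"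
    unfolding mass by (rule Gram_symmetric)
  have "0 < x \<bullet> (mass_matrix lam ns *\<^sub>v x)" if x: "x \<in> carrier_vec ?n" "x \<noteq> 0\<^sub>v ?n" for x
  proof -
    define f where "f y = (\<Sum>i<?n. (x $ i) *\<^sub>R ?g i y)" for y
    have contf: "continuous_on (cbox (0, 0) (1, 1)) (\<lambda>y. (norm (f y))\<^sup>2)"
      unfolding f_def by (intro continuous_intros cont) auto
    obtain k where k: "k < ?n" "x $ k \<noteq> 0"
      using x by (metis carrier_vecD eq_vecI index_zero_vec(1) index_zero_vec(2))
    have "f (ns ! k) = (\<Sum>i<?n. if i = k then x $ i else 0)"
      unfolding f_def using delta k by (intro sum.cong) auto
    then have "f (ns ! k) \<noteq> 0" using k by simp
    moreover have "ns ! k \<in> cbox (0, 0) (1, 1)"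
      using node[OF k(1)] nodes_subset_closure_Omega[OF T] closure_Omega_eq_cbox by blast
    moreover have "box (0, 0) (1, 1) \<noteq> ({} :: (real \<times> real) set)"
      by (auto simp: Omega_def simp flip: Omega_eq_box)
    ultimately have "integral (cbox (0, 0) (1, 1)) (\<lambda>y. (norm (f y))\<^sup>2) \<noteq> 0"
      by (subst integral_cbox_eq_0_iff[OF contf]) auto
    moreover have "0 \<le> integral (cbox (0, 0) (1, 1)) (\<lambda>y. (norm (f y))\<^sup>2)"
      by (intro integral_nonneg integrable_continuous contf) auto
    ultimately have "0 < integral Omega (\<lambda>y. (norm (f y))\<^sup>2)"
      by (simp add: Omega_eq_box integral_open_interval)
    also have "\<dots> = x \<bullet> (mass_matrix lam ns *\<^sub>v x)"
      unfolding mass f_def by (rule Gram_quadratic_form[symmetric, OF _ x(1)]) (rule int)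
    finally show ?thesis .
  qed
  then show ?thesis
    unfolding pos_def_def using sym by (simp add: mass_matrix_def)
qed

text \<open>
  Near an interior point of \<open>t\<close> the function agrees with an affine one, whose gradient is unique.
\<close>
lemma gradient_affine_interior:
  assumes aff: "\<And>y. y \<in> t \<Longrightarrow> f y = inner a y + c" and x: "x \<in> interior t"
  shows "gradient f x = a"
proof -
  have "((\<lambda>y. inner a y + c) has_derivative (\<lambda>h. inner a h)) (at x)"
    by (auto intro!: derivative_eq_intros)
  then have "(f has_derivative (\<lambda>h. inner a h)) (at x)"
    by (rule has_derivative_transform_within_open[OF _ open_interior x])
      (use aff interior_subset[of t] in \<open>auto simp: subset_eq\<close>)
  then have G: "GDERIV f x :> a" by (simp add: gderiv_def inner_commute)
  show ?thesis
    unfolding gradient_def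
  proof (rule the_equality)
    show "GDERIV f x :> a" by (rule G)
  next
    fix D assume "GDERIV f x :> D"
    then have "(\<lambda>h. inner h D) = (\<lambda>h. inner h a)"
      using G has_derivative_unique unfolding gderiv_def by blast
    then show "D = a" by (metis inner_commute vector_eq_rdot)
  qed
qed

text \<open>
  The open triangles cover the square up to their boundaries, which are null sets because triangles
  are convex. Absolute rather than plain integrability is carried through the finite union of the
  open triangles, because it is inherited by unions whose members may overlap.
\<close>
lemma integrable_on_Omega_piecewise_constant:
  fixes f :: "real \<times> real \<Rightarrow> real"
  assumes T: "triangulation_of_Omega T"
    and const: "\<And>t. t \<in> T \<Longrightarrow> \<exists>c. \<forall>y\<in>interior t. f y = c"
  shows "f integrable_on Omega"
proof -
  have fin: "finite T" and cover: "\<Union>T = closure Omega"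
    using T by (auto simp: triangulation_of_Omega_def triangulation_def)
  have convex: "convex t" and compact: "compact t" if "t \<in> T" for t
    using T that convex_simplex compact_simplex
    unfolding triangulation_of_Omega_def by blast+
  have "f absolutely_integrable_on (\<Union>t\<in>T'. interior t)" if "T' \<subseteq> T" for T'
    using finite_subset[OF that fin] that
  proof (induction T')
    case (insert t T')
    have "interior t \<in> lmeasurable"
      using insert.prems compact compact_imp_bounded by (auto intro: lmeasurable_interior)
    moreover obtain c where c: "\<forall>y\<in>interior t. f y = c" using const insert.prems by blast
    ultimately have "f absolutely_integrable_on interior t"
      using set_integrable_cong[of lebesgue lebesgue "interior t" "interior t" f "\<lambda>_. c"]
      by (simp add: absolutely_integrable_on_const)
    with insert show ?case by (simp add: absolutely_integrable_Un)
  qed (simp add: set_integrable_def)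
  then have int: "f integrable_on (\<Union>t\<in>T. interior t)"
    using set_lebesgue_integral_eq_integral(1) by blast
  have "(\<Union>t\<in>T. interior t) \<subseteq> interior (closure Omega)"
    unfolding cover[symmetric] by (intro UN_least interior_mono) blast
  also have "\<dots> = Omega"
    unfolding closure_Omega_eq_cbox interior_cbox by (simp add: Omega_eq_box)
  finally have sub: "(\<Union>t\<in>T. interior t) - Omega = {}" by blast
  have "Omega - (\<Union>t\<in>T. interior t) \<subseteq> (\<Union>t\<in>T. frontier t)"
  proof
    fix y assume y: "y \<in> Omega - (\<Union>t\<in>T. interior t)"
    then obtain t where "t \<in> T" "y \<in> t" using cover closure_subset by blast
    then show "y \<in> (\<Union>t\<in>T. frontier t)"
      using y closure_subset by (auto simp: frontier_def)
  qed
  moreover have "negligible (\<Union>t\<in>T. frontier t)"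
    using fin convex by (auto intro: negligible_Union negligible_convex_frontier)
  ultimately have "negligible (Omega - (\<Union>t\<in>T. interior t))"
    using negligible_subset by blast
  then show ?thesis
    using int sub by (subst integrable_spike_set_eq[where T = "\<Union>t\<in>T. interior t"]) auto
qed

text \<open>
  The basis gradients are constant inside each triangle, hence so are their inner products, and the
  entries are genuine integrals.
\<close>
lemma stiffness_matrix_pos_semidef:
  assumes T: "triangulation_of_Omega T" and ns: "set ns = nodes T"
    and lam: "nodal_basis T lam"
  shows "pos_semidef (length ns) (stiffness_matrix lam ns)"
  unfolding stiffness_matrix_def
proof (rule pos_semidef_Gram, rule integrable_on_Omega_piecewise_constant[OF T])
  fix i j t assume ij: "i < length ns" "j < length ns" and t: "t \<in> T"
  have const: "\<exists>a. \<forall>y\<in>interior t. gradient (lam (ns ! i)) y = a" if "i < length ns" for i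
  proof -
    have "lam (ns ! i) \<in> fe_space T"
      using lam that ns by (metis nodal_basis_def nth_mem)
    then obtain a :: "real \<times> real" and c where "\<forall>y\<in>t. lam (ns ! i) y = inner a y + c"
      using t unfolding fe_space_def by blast
    then have "gradient (lam (ns ! i)) y = a" if "y \<in> interior t" for y
      using that by (intro gradient_affine_interior) auto
    then show ?thesis by blast
  qed
  obtain a b where "\<forall>y\<in>interior t. gradient (lam (ns ! i)) y = a"
    "\<forall>y\<in>interior t. gradient (lam (ns ! j)) y = b"
    using const[OF ij(1)] const[OF ij(2)] by blast
  then show "\<exists>c. \<forall>y\<in>interior t. inner (gradient (lam (ns ! i)) y) (gradient (lam (ns ! j)) y) = c"
    by auto
qed

lemma Kbar_pos_semidef:
  assumes "triangulation_of_Omega T" "set ns = nodes T" "nodal_basis T lam"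
  shows "pos_semidef (length ns) (Kbar lam ns)"
  unfolding Kbar_def
  by (intro pos_semidef_add pos_semidef_outer_product stiffness_matrix_pos_semidef[OF assms])

lemma bd_preconditioner_pos_def:
  assumes "\<eta> > 0" and T: "triangulation_of_Omega T" "distinct ns" "set ns = nodes T" "nodal_basis T lam"
  shows "pos_def (2 * length ns) (bd_preconditioner \<eta> lam ns)"
  unfolding bd_preconditioner_def mult_2
  using assms(1)
  by (intro pos_def_block_diagonal pos_def_add_pos_semidef pos_def_smult pos_semidef_smult
      mass_matrix_pos_def[OF T] Kbar_pos_semidef[OF T(1,3,4)]) auto

lemma saddle_matrix_symmetric:
  assumes T: "triangulation_of_Omega T" "distinct ns" "set ns = nodes T" "nodal_basis T lam"
  shows "saddle_matrix \<eta> lam ns \<in> carrier_mat (2 * length ns) (2 * length ns)"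
    and "transpose_mat (saddle_matrix \<eta> lam ns) = saddle_matrix \<eta> lam ns"
proof -
  let ?n = "length ns"
  have M: "mass_matrix lam ns \<in> carrier_mat ?n ?n" "transpose_mat (mass_matrix lam ns) = mass_matrix lam ns"
    using mass_matrix_pos_def[OF T] by (auto simp: pos_def_def)
  have K: "Kbar lam ns \<in> carrier_mat ?n ?n" "transpose_mat (Kbar lam ns) = Kbar lam ns"
    using Kbar_pos_semidef[OF T(1,3,4)] by (auto simp: pos_semidef_def)
  show "saddle_matrix \<eta> lam ns \<in> carrier_mat (2 * ?n) (2 * ?n)"
    unfolding saddle_matrix_def mult_2 using K M by auto
  show "transpose_mat (saddle_matrix \<eta> lam ns) = saddle_matrix \<eta> lam ns"
    unfolding saddle_matrix_def using K M
    by (simp add: transpose_four_block_mat[of _ ?n ?n _ ?n _ ?n] transpose_smult_mat)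
qed

theorem lemma5p2:
  fixes \<eta> :: real
    and T :: "(real \<times> real) set set"
    and ns :: "(real \<times> real) list"
    and lam :: "real \<times> real \<Rightarrow> real \<times> real \<Rightarrow> real"
    and X :: "(real \<times> real) set"
  assumes "\<eta> > 0"
    and "triangulation_of_Omega T"
    and "distinct ns" and "set ns = nodes T"
    and "nodal_basis T lam"
    and "X \<subseteq> nodes T" and "card X \<ge> 1"
  shows "lambda_min (inv_mat (truncate_mat ns X (bd_preconditioner \<eta> lam ns)) *
                     truncate_mat ns X (saddle_matrix \<eta> lam ns))
         \<ge> lambda_min (inv_mat (bd_preconditioner \<eta> lam ns) * saddle_matrix \<eta> lam ns)
       \<and> lambda_max (inv_mat (truncate_mat ns X (bd_preconditioner \<eta> lam ns)) *
                     truncate_mat ns X (saddle_matrix \<eta> lam ns))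
         \<le> lambda_max (inv_mat (bd_preconditioner \<eta> lam ns) * saddle_matrix \<eta> lam ns)"
proof -
  define I where "I = {0..<2 * length ns} - {i. i < length ns \<and> ns ! i \<in> X}"
  have "X \<noteq> {}" using assms(7) by auto
  then have "length ns > 0" using assms(4,6) by (cases ns) auto
  (* The index length ns is the first one of the second block, which truncation leaves alone. *)
  then have "length ns \<in> I" by (simp add: I_def)
  then have "I \<noteq> {}" by blast
  moreover have "I \<subseteq> {..<2 * length ns}" by (auto simp: I_def)
  ultimately have I: "I \<subseteq> {..<2 * length ns}" "I \<noteq> {}" by blast+
  have trunc: "truncate_mat ns X A = submatrix A I I" for A
    by (simp add: truncate_mat_def I_def Let_def)
  show ?thesis
    unfolding trunc
    using pencil_extreme_eigenvalues_submatrix[OF bd_preconditioner_pos_def[OF assms(1-5)]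
        saddle_matrix_symmetric[OF assms(2-5)] I] by blast
qed

end
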